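(* Let $P$ be a default-enabled poset, and let $G$ be a set of preclosure maps on $P$. The set $\mathrm{fix}(G)=\{x\in P: g(x)=x\text{ for every }g\in G\}$ is a closure system in $P$, and the closure operator $\overline{G}$ on $P$ which has $\mathrm{fix}(\overline{G})=\mathrm{fix}(G)$ is the least closure operator on $P$ that is above $G$. The following induction principle holds: if a subset $A$ of $P$ is default-enabled within $P$ and is closed under $G$, then it is closed under $\overline{G}$.
   Context: A poset has a ceiling if each of its elements is below some maximal element of it (the empty poset has a ceiling); a subset of a poset has a ceiling if it does so as a subposet. A poset $P$ is default-enabled if for every subset $X\subseteq P$ (including $X=\emptyset$) the set of all lower bounds of $X$ in $P$ has a ceiling. A subset $A$ of a poset $P$ is default-enabled within $P$ if (i) the subposet $A$ is default-enabled, and (ii) for every $x\in P$ the set $\{y\in A: y\le x\}$ has a ceiling. A preclosure map on $P$ is a map $f:P\to P$ that is increasing and ascending ($x\le f(x)$); a closure operator is an idempotent preclosure map; maps are ordered pointwise, and a closure operator $h$ is above $G$ if $h\ge g$ for all $g\in G$. A closure system in $P$ is the fixpoint set of a closure operator on $P$; it determines the closure operator uniquely. A subset $A$ is closed under $G$ if $g(A)\subseteq A$ for all $g\in G$, and closed under $\overline{G}$ if $\overline{G}(A)\subseteq A$. *)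

theory Defs
  imports "HOL-Library.FuncSet"
begin

text \<open>
  A poset is a subset of a type of class \<open>order\<close>, with the restricted order; it may be empty.
  Subposets are then just subsets.
\<close>

definition maximal_in :: "'a::order set \<Rightarrow> 'a \<Rightarrow> bool" where
  "maximal_in S m \<longleftrightarrow> m \<in> S \<and> (\<forall>y\<in>S. m \<le> y \<longrightarrow> y = m)"

definition has_ceiling :: "'a::order set \<Rightarrow> bool" where
  "has_ceiling S \<longleftrightarrow> (\<forall>x\<in>S. \<exists>m. maximal_in S m \<and> x \<le> m)"

definition lower_bounds :: "'a::order set \<Rightarrow> 'a set \<Rightarrow> 'a set" where
  "lower_bounds P X = {y \<in> P. \<forall>x\<in>X. y \<le> x}"

definition default_enabled :: "'a::order set \<Rightarrow> bool" where
  "default_enabled P \<longleftrightarrow> (\<forall>X. X \<subseteq> P \<longrightarrow> has_ceiling (lower_bounds P X))"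

definition default_enabled_within :: "'a::order set \<Rightarrow> 'a set \<Rightarrow> bool" where
  "default_enabled_within P A \<longleftrightarrow>
     A \<subseteq> P \<and> default_enabled A \<and> (\<forall>x\<in>P. has_ceiling {y \<in> A. y \<le> x})"

text \<open>
  Maps on \<open>P\<close> are extensional (\<open>undefined\<close> outside \<open>P\<close>), so that equality of HOL functions is
  equality of maps and a closure operator can be uniquely determined by its fixpoint set.
\<close>

definition preclosure_map :: "'a::order set \<Rightarrow> ('a \<Rightarrow> 'a) \<Rightarrow> bool" where
  "preclosure_map P f \<longleftrightarrow> f \<in> P \<rightarrow>\<^sub>E P \<and> mono_on P f \<and> (\<forall>x\<in>P. x \<le> f x)"

definition closure_operator :: "'a::order set \<Rightarrow> ('a \<Rightarrow> 'a) \<Rightarrow> bool" where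
  "closure_operator P f \<longleftrightarrow> preclosure_map P f \<and> (\<forall>x\<in>P. f (f x) = f x)"

definition map_le :: "'a::order set \<Rightarrow> ('a \<Rightarrow> 'a) \<Rightarrow> ('a \<Rightarrow> 'a) \<Rightarrow> bool" where
  "map_le P f g \<longleftrightarrow> (\<forall>x\<in>P. f x \<le> g x)"

definition above :: "'a::order set \<Rightarrow> ('a \<Rightarrow> 'a) \<Rightarrow> ('a \<Rightarrow> 'a) set \<Rightarrow> bool" where
  "above P h G \<longleftrightarrow> (\<forall>g\<in>G. map_le P g h)"

definition least_closure_operator_above ::
    "'a::order set \<Rightarrow> ('a \<Rightarrow> 'a) set \<Rightarrow> ('a \<Rightarrow> 'a) \<Rightarrow> bool" where
  "least_closure_operator_above P G h \<longleftrightarrow>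
     closure_operator P h \<and> above P h G \<and>
     (\<forall>k. closure_operator P k \<and> above P k G \<longrightarrow> map_le P h k)"

definition fixpoints :: "'a set \<Rightarrow> ('a \<Rightarrow> 'a) set \<Rightarrow> 'a set" where
  "fixpoints P G = {x \<in> P. \<forall>g\<in>G. g x = x}"

definition closure_system :: "'a::order set \<Rightarrow> 'a set \<Rightarrow> bool" where
  "closure_system P C \<longleftrightarrow> (\<exists>h. closure_operator P h \<and> fixpoints P {h} = C)"

text \<open>The closure operator determined by a closure system; meaningless for other sets \<open>C\<close>.\<close>

definition closure_operator_of :: "'a::order set \<Rightarrow> 'a set \<Rightarrow> 'a \<Rightarrow> 'a" where
  "closure_operator_of P C = (THE h. closure_operator P h \<and> fixpoints P {h} = C)"

definition generated_closure :: "'a::order set \<Rightarrow> ('a \<Rightarrow> 'a) set \<Rightarrow> 'a \<Rightarrow> 'a" where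
  "generated_closure P G = closure_operator_of P (fixpoints P G)"

definition closed_under :: "'a set \<Rightarrow> ('a \<Rightarrow> 'a) set \<Rightarrow> bool" where
  "closed_under A G \<longleftrightarrow> (\<forall>g\<in>G. g ` A \<subseteq> A)"

end

theory Submission
  imports Defs
begin

text \<open>
  Let \<open>Y\<close> be the set of fixpoints of \<open>G\<close> above \<open>x\<close>. The lower bounds of \<open>Y\<close> are closed under \<open>G\<close>
  and contain \<open>x\<close>, so a maximal lower bound of \<open>Y\<close> above \<open>x\<close> is itself a fixpoint, hence the
  least element of \<open>Y\<close>. Mapping \<open>x\<close> to it is the wanted closure operator. The same maximality
  argument inside \<open>{y \<in> A. y \<le> c}\<close>, with \<open>c\<close> the closure of \<open>x \<in> A\<close>, gives the induction principle.
\<close>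

definition least_above :: "'a::order set \<Rightarrow> 'a \<Rightarrow> 'a \<Rightarrow> bool" where
  "least_above C x m \<longleftrightarrow> m \<in> C \<and> x \<le> m \<and> (\<forall>y\<in>C. x \<le> y \<longrightarrow> m \<le> y)"

lemma least_above_unique: "least_above C x m \<Longrightarrow> least_above C x n \<Longrightarrow> m = n"
  unfolding least_above_def by (meson order.antisym)

lemma preclosure_mapD:
  assumes "preclosure_map P f"
  shows "x \<in> P \<Longrightarrow> f x \<in> P"
    and "x \<in> P \<Longrightarrow> x \<le> f x"
    and "x \<in> P \<Longrightarrow> y \<in> P \<Longrightarrow> x \<le> y \<Longrightarrow> f x \<le> f y"
  using assms by (auto simp: preclosure_map_def mono_on_def)

text \<open>For a closure operator, \<open>h x\<close> is fixed by idempotence, and a fixpoint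
  \<open>y\<close> above \<open>x\<close> gives \<open>h x \<le> h y = y\<close>. Building or
  comparing closure operators thus reduces to finding least fixpoints, while
  \<open>extensional P\<close> pins down the values outside \<open>P\<close>.\<close>

lemma closure_operator_iff_least_above:
  assumes "C \<subseteq> P"
  shows "closure_operator P h \<and> fixpoints P {h} = C \<longleftrightarrow>
    h \<in> extensional P \<and> (\<forall>x\<in>P. least_above C x (h x))" (is "?L \<longleftrightarrow> ?R")
proof
  assume L: ?L
  then have pre: "preclosure_map P h" and idem: "\<And>x. x \<in> P \<Longrightarrow> h (h x) = h x"
    by (auto simp: closure_operator_def)
  note h = preclosure_mapD[OF pre]
  have C: "y \<in> C \<longleftrightarrow> y \<in> P \<and> h y = y" for y
    using L by (auto simp: fixpoints_def)
  have "least_above C x (h x)" if "x \<in> P" for x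
    unfolding least_above_def using C h idem that by metis
  moreover have "h \<in> extensional P"
    using pre by (auto simp: preclosure_map_def PiE_def)
  ultimately show ?R by blast
next
  assume R: ?R
  then have least: "\<And>x. x \<in> P \<Longrightarrow> least_above C x (h x)" by blast
  then have hC: "h x \<in> C" and asc: "x \<le> h x" if "x \<in> P" for x
    using that by (auto simp: least_above_def)
  have min: "h x \<le> y" if "x \<in> P" "y \<in> C" "x \<le> y" for x y
    using least that by (auto simp: least_above_def)
  have fixed: "h y = y" if "y \<in> C" for y
    using that assms asc min by (meson order.antisym order.refl subsetD)
  \<comment> \<open>For \<open>x \<le> y\<close>, \<open>h y\<close> is a member of \<open>C\<close>
    above \<open>x\<close>, so leastness of \<open>h x\<close> applies.\<close>
  have "mono_on P h"
    by (intro mono_onI) (meson asc hC min order.trans)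
  moreover have "h \<in> P \<rightarrow>\<^sub>E P"
    using R hC assms by (auto simp: PiE_def)
  ultimately have "closure_operator P h"
    using asc hC fixed by (simp add: closure_operator_def preclosure_map_def)
  moreover have "fixpoints P {h} = C"
    using assms hC fixed by (auto simp: fixpoints_def) (metis hC)
  ultimately show ?L by blast
qed

text \<open>On \<open>P\<close> both maps take the least fixpoint above the argument; outside
  \<open>P\<close> both are \<open>undefined\<close>.\<close>

lemma closure_operator_unique:
  assumes "closure_operator P h" "closure_operator P k" "fixpoints P {h} = fixpoints P {k}"
  shows "h = k"
proof -
  let ?C = "fixpoints P {k}"
  have C: "?C \<subseteq> P" by (auto simp: fixpoints_def)
  have h: "h \<in> extensional P \<and> (\<forall>x\<in>P. least_above ?C x (h x))"
    and k: "k \<in> extensional P \<and> (\<forall>x\<in>P. least_above ?C x (k x))"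
    using assms closure_operator_iff_least_above[OF C] by blast+
  show ?thesis
    by (rule extensionalityI[of _ P]) (use h k least_above_unique in blast)+
qed

text \<open>Ascent puts \<open>g m\<close> above \<open>m\<close>, and maximality allows nothing
  larger inside \<open>S\<close>. Both the existence of least fixpoints and the induction principle
  obtain their fixpoint this way.\<close>

lemma maximal_closed_fixed:
  assumes "maximal_in S m" and "preclosure_map P g" "m \<in> P" "g m \<in> S"
  shows "g m = m"
  using assms preclosure_mapD(2) unfolding maximal_in_def by blast

text \<open>Monotonicity gives \<open>g y \<le> g c = c\<close>. Hence bounds by fixpoints survive
  applying \<open>G\<close>, which keeps \<open>g m\<close> in the sets where \<open>m\<close> is
  maximal.\<close>

lemma preclosure_map_le_fixpoint:
  assumes "preclosure_map P g" "g \<in> G" "c \<in> fixpoints P G" "y \<in> P" "y \<le> c"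
  shows "g y \<le> c"
  using assms preclosure_mapD(3)[of P g y c] by (auto simp: fixpoints_def)

lemma ex_least_fixpoint_above:
  assumes "default_enabled P" and G: "\<forall>g\<in>G. preclosure_map P g" and "x \<in> P"
  shows "\<exists>m. least_above (fixpoints P G) x m"
proof -
  let ?Y = "{y \<in> fixpoints P G. x \<le> y}"
  let ?L = "lower_bounds P ?Y"
  \<comment> \<open>\<open>?Y\<close> may be empty; then \<open>?L\<close> is all of
    \<open>P\<close>, and the ceiling comes from the case \<open>X = {}\<close> of
    default-enabledness.\<close>
  have "has_ceiling ?L"
    using assms(1) by (auto simp: default_enabled_def fixpoints_def)
  moreover have "x \<in> ?L"
    using assms(3) by (auto simp: lower_bounds_def)
  ultimately obtain m where m: "maximal_in ?L m" "x \<le> m"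
    by (auto simp: has_ceiling_def)
  then have mL: "m \<in> ?L" and mP: "m \<in> P"
    by (auto simp: maximal_in_def lower_bounds_def)
  have "g m = m" if g: "g \<in> G" for g
  proof (rule maximal_closed_fixed[OF m(1) _ mP])
    show "preclosure_map P g" using G g by blast
    then show "g m \<in> ?L"
      using mL mP g preclosure_mapD(1) preclosure_map_le_fixpoint
      by (fastforce simp: lower_bounds_def)
  qed
  then have "least_above (fixpoints P G) x m"
    using m mL mP by (auto simp: least_above_def fixpoints_def lower_bounds_def)
  then show ?thesis ..
qed

lemma ex1_closure_operator_fixpoints:
  assumes "default_enabled P" "\<forall>g\<in>G. preclosure_map P g"
  shows "\<exists>!h. closure_operator P h \<and> fixpoints P {h} = fixpoints P G"
proof (rule ex_ex1I)
  obtain f where "\<forall>x\<in>P. least_above (fixpoints P G) x (f x)"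
    using ex_least_fixpoint_above[OF assms] by metis
  \<comment> \<open>Restriction makes the chosen function extensional, as a map on \<open>P\<close>
    must be.\<close>
  then have "restrict f P \<in> extensional P \<and>
      (\<forall>x\<in>P. least_above (fixpoints P G) x (restrict f P x))"
    by simp
  moreover have "fixpoints P G \<subseteq> P"
    by (auto simp: fixpoints_def)
  ultimately show "\<exists>h. closure_operator P h \<and> fixpoints P {h} = fixpoints P G"
    using closure_operator_iff_least_above by blast
qed (metis closure_operator_unique)

text \<open>A closure operator \<open>k\<close> above \<open>G\<close> satisfies
  \<open>k x \<le> g (k x) \<le> k (k x) = k x\<close>, so \<open>k x\<close> is a fixpoint of
  \<open>G\<close> above \<open>x\<close>, and \<open>h x\<close> is the least of these.\<close>

lemma least_closure_operator_aboveI: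
  assumes h: "closure_operator P h" "fixpoints P {h} = fixpoints P G"
    and G: "\<forall>g\<in>G. preclosure_map P g"
  shows "least_closure_operator_above P G h"
proof -
  have "fixpoints P G \<subseteq> P" by (auto simp: fixpoints_def)
  then have least: "least_above (fixpoints P G) x (h x)" if "x \<in> P" for x
    using h closure_operator_iff_least_above that by blast
  \<comment> \<open>\<open>h x\<close> is a fixpoint of \<open>G\<close> above \<open>x\<close>,
    hence bounds \<open>g x\<close>.\<close>
  have "above P h G"
    using G least preclosure_map_le_fixpoint
    unfolding above_def map_le_def least_above_def by blast
  moreover have "map_le P h k" if k: "closure_operator P k" "above P k G" for k
    unfolding map_le_def
  proof
    fix x assume x: "x \<in> P"
    have pre: "preclosure_map P k" and idem: "k (k x) = k x"
      using k(1) x by (auto simp: closure_operator_def)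
    note kx = preclosure_mapD(1,2)[OF pre x]
    have "g (k x) = k x" if g: "g \<in> G" for g
    proof (rule order.antisym)
      show "g (k x) \<le> k x"
        using k(2) g kx(1) idem by (metis above_def map_le_def)
      show "k x \<le> g (k x)"
        using G g kx(1) preclosure_mapD(2) by blast
    qed
    with kx have "k x \<in> fixpoints P G" by (simp add: fixpoints_def)
    with least[OF x] kx show "h x \<le> k x" by (auto simp: least_above_def)
  qed
  ultimately show ?thesis
    using h(1) by (auto simp: least_closure_operator_above_def)
qed

lemma closure_operator_induction:
  assumes h: "closure_operator P h" "fixpoints P {h} = fixpoints P G"
    and G: "\<forall>g\<in>G. preclosure_map P g"
    and A: "A \<subseteq> P" "\<forall>x\<in>P. has_ceiling {y \<in> A. y \<le> x}" "closed_under A G"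
  shows "closed_under A {h}"
proof -
  have "h x \<in> A" if x: "x \<in> A" for x
  proof -
    \<comment> \<open>Cutting \<open>A\<close> off at \<open>h x\<close> keeps it closed under
      \<open>G\<close>, since \<open>h x\<close> is fixed by \<open>G\<close>.\<close>
    let ?S = "{y \<in> A. y \<le> h x}"
    have FP: "fixpoints P G \<subseteq> P" by (auto simp: fixpoints_def)
    then have least: "least_above (fixpoints P G) x (h x)"
      using h closure_operator_iff_least_above x A(1) by blast
    then have hx: "h x \<in> fixpoints P G" "x \<le> h x"
      by (auto simp: least_above_def)
    with FP A(2) x obtain m where m: "maximal_in ?S m" "x \<le> m"
      unfolding has_ceiling_def by blast
    then have mS: "m \<in> A" "m \<le> h x" and mP: "m \<in> P"
      using A(1) by (auto simp: maximal_in_def)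
    have "g m = m" if g: "g \<in> G" for g
    proof (rule maximal_closed_fixed[OF m(1) _ mP])
      show pre: "preclosure_map P g" using G g by blast
      show "g m \<in> ?S"
        using preclosure_map_le_fixpoint[OF pre g hx(1) mP mS(2)] A(3) g mS(1)
        by (auto simp: closed_under_def)
    qed
    with mP have "m \<in> fixpoints P G" by (simp add: fixpoints_def)
    \<comment> \<open>Leastness gives \<open>h x \<le> m\<close>, membership in \<open>?S\<close>
      gives \<open>m \<le> h x\<close>, so \<open>h x\<close> is the element \<open>m\<close> of
      \<open>A\<close>.\<close>
    with least m(2) have "h x \<le> m" by (auto simp: least_above_def)
    with mS show ?thesis by (simp add: order.antisym)
  qed
  then show ?thesis by (auto simp: closed_under_def)
qed

theorem theorem8p4:
  fixes P :: "'a::order set" and G :: "('a \<Rightarrow> 'a) set"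
  assumes "default_enabled P"
    and "\<forall>g\<in>G. preclosure_map P g"
  shows "closure_system P (fixpoints P G) \<and>
    (\<exists>!h. closure_operator P h \<and> fixpoints P {h} = fixpoints P G) \<and>
    closure_operator P (generated_closure P G) \<and>
    fixpoints P {generated_closure P G} = fixpoints P G \<and>
    least_closure_operator_above P G (generated_closure P G) \<and>
    (\<forall>A. default_enabled_within P A \<and> closed_under A G \<longrightarrow>
         closed_under A {generated_closure P G})"
proof -
  note ex1 = ex1_closure_operator_fixpoints[OF assms]
  \<comment> \<open>Unique existence gives the \<open>THE\<close> behind
    \<open>generated_closure\<close> its meaning.\<close>
  have gen: "closure_operator P (generated_closure P G)"
      "fixpoints P {generated_closure P G} = fixpoints P G"
    using theI'[OF ex1] unfolding generated_closure_def closure_operator_of_def by blast+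
  have "closure_system P (fixpoints P G)"
    using gen unfolding closure_system_def by blast
  moreover have "least_closure_operator_above P G (generated_closure P G)"
    by (rule least_closure_operator_aboveI[OF gen assms(2)])
  moreover have "\<forall>A. default_enabled_within P A \<and> closed_under A G \<longrightarrow>
      closed_under A {generated_closure P G}"
    using closure_operator_induction[OF gen assms(2)]
    unfolding default_enabled_within_def by blast
  ultimately show ?thesis using ex1 gen by blast
qed

end
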